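(* Let $\mathbf{FStoch}$ be the symmetric monoidal category of finite sets and matrices with nonnegative real entries, where each finite set $A$ is equipped with the completely mixed state $\mu_A\colon I\to A$ (the column vector of $1$s) and the discarding effect $\varepsilon_A\colon A\to I$ (the row vector of $1$s). The symmetric monoidal subcategory $\mathcal P$ of pure morphisms consists of precisely those matrices which have at most one nonzero entry in each column. Dually, the symmetric monoidal subcategory $\mathcal C$ of copure morphisms consists of precisely those matrices which have at most one nonzero entry in each row.
   Context: $\mathbf{FStoch}$: objects are finite sets; a morphism $f\colon X\to Y$ is a matrix $(f_{yx})_{y\in Y,x\in X}$ of nonnegative reals, with the domain labelling the columns and the codomain labelling the rows (no normalisation). Composition is matrix multiplication; the monoidal product is the Cartesian product of sets and the Kronecker product of matrices; the unit $I$ is a one-element set. Lifting: for morphisms $f\colon A\to B$ and $g\colon C\to D$ of a category, $f$ has the lifting property against $g$ when for all $u\colon A\to C$, $v\colon B\to D$ with $g\circ u=v\circ f$ there is $h\colon B\to C$ with $h\circ f=u$ and $g\circ h=v$. In a symmetric monoidal category, $f\oslash g$ means: for all objects $A',B'$, the morphism $f\otimes\mathrm{id}_{A'}$ has the lifting property against $g\otimes\mathrm{id}_{B'}$. For a collection $\mathcal A$ of morphisms, $\mathcal A^{\oslash}=\{g\mid \forall f\in\mathcal A\colon f\oslash g\}$ and ${}^{\oslash}\mathcal A=\{f\mid\forall g\in\mathcal A\colon f\oslash g\}$. Let $\mathcal M'$ be the collection of all completely mixed states $\mu_A$ and $\mathcal D'$ the collection of all discarding effects $\varepsilon_A$ ($A$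 ranging over all finite sets). The class of pure morphisms is $\mathcal P=\mathcal M'^{\oslash}$, and the class of copure morphisms is $\mathcal C={}^{\oslash}\mathcal D'$.
   Formalization: The completely mixed states and discarding effects used to define pure and copure morphisms range over nonempty finite sets A only; with A empty, matrices having a zero column (resp. zero row) would fail the lifting property, so the claim would be false as stated. *)

theory Defs
  imports Complex_Main
begin

section \<open>Symmetric monoidal categories and lifting\<close>

record ('o, 'm) smcat =
  Obj :: "'o set"
  Arr :: "'m set"
  Dom :: "'m \<Rightarrow> 'o"
  Cod :: "'m \<Rightarrow> 'o"
  Id :: "'o \<Rightarrow> 'm"
  Comp :: "'m \<Rightarrow> 'm \<Rightarrow> 'm"    (infixl \<open>\<circ>\<index>\<close> 55)
  TensorO :: "'o \<Rightarrow> 'o \<Rightarrow> 'o"  (infixr \<open>\<odot>\<index>\<close> 70)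
  Tensor :: "'m \<Rightarrow> 'm \<Rightarrow> 'm"   (infixr \<open>\<otimes>\<index>\<close> 70)
  Unit :: 'o
  Assoc :: "'o \<Rightarrow> 'o \<Rightarrow> 'o \<Rightarrow> 'm"
  LUnit :: "'o \<Rightarrow> 'm"
  RUnit :: "'o \<Rightarrow> 'm"
  Sym :: "'o \<Rightarrow> 'o \<Rightarrow> 'm"

definition hom :: "('o, 'm) smcat \<Rightarrow> 'o \<Rightarrow> 'o \<Rightarrow> 'm set" where
  "hom C X Y = {f \<in> Arr C. Dom C f = X \<and> Cod C f = Y}"

definition inverse_arrows :: "('o, 'm) smcat \<Rightarrow> 'm \<Rightarrow> 'm \<Rightarrow> bool" where
  "inverse_arrows C f g \<longleftrightarrow>
     f \<in> Arr C \<and> g \<in> hom C (Cod C f) (Dom C f) \<and>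
     g \<circ>\<^bsub>C\<^esub> f = Id C (Dom C f) \<and> f \<circ>\<^bsub>C\<^esub> g = Id C (Cod C f)"

definition structure_arrows :: "('o, 'm) smcat \<Rightarrow> 'm set" where
  "structure_arrows C =
     {Assoc C X Y Z |X Y Z. X \<in> Obj C \<and> Y \<in> Obj C \<and> Z \<in> Obj C} \<union>
     LUnit C ` Obj C \<union> RUnit C ` Obj C \<union>
     {Sym C X Y |X Y. X \<in> Obj C \<and> Y \<in> Obj C}"

locale symmetric_monoidal_category =
  fixes C :: "('o, 'm) smcat" (structure)
  assumes ends: "f \<in> Arr C \<Longrightarrow> Dom C f \<in> Obj C \<and> Cod C f \<in> Obj C"
    and id_hom: "X \<in> Obj C \<Longrightarrow> Id C X \<in> hom C X X"
    and comp_hom: "\<lbrakk>f \<in> hom C X Y; g \<in> hom C Y Z\<rbrakk> \<Longrightarrow> g \<circ> f \<in> hom C X Z"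
    and id_left: "f \<in> hom C X Y \<Longrightarrow> Id C Y \<circ> f = f"
    and id_right: "f \<in> hom C X Y \<Longrightarrow> f \<circ> Id C X = f"
    and comp_assoc: "\<lbrakk>f \<in> hom C W X; g \<in> hom C X Y; h \<in> hom C Y Z\<rbrakk>
      \<Longrightarrow> (h \<circ> g) \<circ> f = h \<circ> (g \<circ> f)"
    and unit_obj: "Unit C \<in> Obj C"
    and tensor_obj: "\<lbrakk>X \<in> Obj C; Y \<in> Obj C\<rbrakk> \<Longrightarrow> X \<odot> Y \<in> Obj C"
    and tensor_hom: "\<lbrakk>f \<in> hom C X Y; f' \<in> hom C X' Y'\<rbrakk>
      \<Longrightarrow> f \<otimes> f' \<in> hom C (X \<odot> X') (Y \<odot> Y')"
    and tensor_id: "\<lbrakk>X \<in> Obj C; Y \<in> Obj C\<rbrakk> \<Longrightarrow> Id C X \<otimes> Id C Y = Id C (X \<odot> Y)"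
    and interchange: "\<lbrakk>f \<in> hom C X Y; g \<in> hom C Y Z; f' \<in> hom C X' Y'; g' \<in> hom C Y' Z'\<rbrakk>
      \<Longrightarrow> (g \<circ> f) \<otimes> (g' \<circ> f') = (g \<otimes> g') \<circ> (f \<otimes> f')"
    and assoc_hom: "\<lbrakk>X \<in> Obj C; Y \<in> Obj C; Z \<in> Obj C\<rbrakk>
      \<Longrightarrow> Assoc C X Y Z \<in> hom C ((X \<odot> Y) \<odot> Z) (X \<odot> Y \<odot> Z)"
    and lunit_hom: "X \<in> Obj C \<Longrightarrow> LUnit C X \<in> hom C (Unit C \<odot> X) X"
    and runit_hom: "X \<in> Obj C \<Longrightarrow> RUnit C X \<in> hom C (X \<odot> Unit C) X"
    and sym_hom: "\<lbrakk>X \<in> Obj C; Y \<in> Obj C\<rbrakk> \<Longrightarrow> Sym C X Y \<in> hom C (X \<odot> Y) (Y \<odot> X)"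
    and structure_iso: "a \<in> structure_arrows C \<Longrightarrow> \<exists>b. inverse_arrows C a b"
    and assoc_natural: "\<lbrakk>f \<in> hom C X X'; g \<in> hom C Y Y'; h \<in> hom C Z Z'\<rbrakk>
      \<Longrightarrow> Assoc C X' Y' Z' \<circ> ((f \<otimes> g) \<otimes> h) = (f \<otimes> g \<otimes> h) \<circ> Assoc C X Y Z"
    and lunit_natural: "f \<in> hom C X Y \<Longrightarrow> LUnit C Y \<circ> (Id C (Unit C) \<otimes> f) = f \<circ> LUnit C X"
    and runit_natural: "f \<in> hom C X Y \<Longrightarrow> RUnit C Y \<circ> (f \<otimes> Id C (Unit C)) = f \<circ> RUnit C X"
    and sym_natural: "\<lbrakk>f \<in> hom C X X'; g \<in> hom C Y Y'\<rbrakk>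
      \<Longrightarrow> Sym C X' Y' \<circ> (f \<otimes> g) = (g \<otimes> f) \<circ> Sym C X Y"
    and pentagon: "\<lbrakk>W \<in> Obj C; X \<in> Obj C; Y \<in> Obj C; Z \<in> Obj C\<rbrakk>
      \<Longrightarrow> Assoc C W X (Y \<odot> Z) \<circ> Assoc C (W \<odot> X) Y Z =
          (Id C W \<otimes> Assoc C X Y Z) \<circ> Assoc C W (X \<odot> Y) Z \<circ> (Assoc C W X Y \<otimes> Id C Z)"
    and triangle: "\<lbrakk>X \<in> Obj C; Y \<in> Obj C\<rbrakk>
      \<Longrightarrow> (Id C X \<otimes> LUnit C Y) \<circ> Assoc C X (Unit C) Y = RUnit C X \<otimes> Id C Y"
    and sym_sym: "\<lbrakk>X \<in> Obj C; Y \<in> Obj C\<rbrakk> \<Longrightarrow> Sym C Y X \<circ> Sym C X Y = Id C (X \<odot> Y)"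
    and hexagon: "\<lbrakk>X \<in> Obj C; Y \<in> Obj C; Z \<in> Obj C\<rbrakk>
      \<Longrightarrow> Assoc C Y Z X \<circ> Sym C X (Y \<odot> Z) \<circ> Assoc C X Y Z =
          (Id C Y \<otimes> Sym C X Z) \<circ> Assoc C Y X Z \<circ> (Sym C X Y \<otimes> Id C Z)"

text \<open>A class of arrows is identified with the wide subcategory it spans.\<close>

definition symmetric_monoidal_subcategory :: "('o, 'm) smcat \<Rightarrow> 'm set \<Rightarrow> bool" where
  "symmetric_monoidal_subcategory C S \<longleftrightarrow>
     S \<subseteq> Arr C \<and>
     (\<forall>X\<in>Obj C. Id C X \<in> S) \<and>
     (\<forall>f\<in>S. \<forall>g\<in>S. Cod C f = Dom C g \<longrightarrow> g \<circ>\<^bsub>C\<^esub> f \<in> S) \<and>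
     (\<forall>f\<in>S. \<forall>g\<in>S. f \<otimes>\<^bsub>C\<^esub> g \<in> S) \<and>
     (\<forall>a\<in>structure_arrows C. a \<in> S \<and> (\<exists>b\<in>S. inverse_arrows C a b))"

definition lifts :: "('o, 'm) smcat \<Rightarrow> 'm \<Rightarrow> 'm \<Rightarrow> bool" where
  "lifts C f g \<longleftrightarrow>
     (\<forall>u \<in> hom C (Dom C f) (Dom C g). \<forall>v \<in> hom C (Cod C f) (Cod C g).
        g \<circ>\<^bsub>C\<^esub> u = v \<circ>\<^bsub>C\<^esub> f \<longrightarrow>
        (\<exists>h \<in> hom C (Cod C f) (Dom C g). h \<circ>\<^bsub>C\<^esub> f = u \<and> g \<circ>\<^bsub>C\<^esub> h = v))"

definition tensor_lifts :: "('o, 'm) smcat \<Rightarrow> 'm \<Rightarrow> 'm \<Rightarrow> bool" where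
  "tensor_lifts C f g \<longleftrightarrow>
     (\<forall>A\<in>Obj C. \<forall>B\<in>Obj C. lifts C (f \<otimes>\<^bsub>C\<^esub> Id C A) (g \<otimes>\<^bsub>C\<^esub> Id C B))"

definition right_lifting_class :: "('o, 'm) smcat \<Rightarrow> 'm set \<Rightarrow> 'm set" where
  "right_lifting_class C \<A> = {g \<in> Arr C. \<forall>f\<in>\<A>. tensor_lifts C f g}"

definition left_lifting_class :: "('o, 'm) smcat \<Rightarrow> 'm set \<Rightarrow> 'm set" where
  "left_lifting_class C \<A> = {f \<in> Arr C. \<forall>g\<in>\<A>. tensor_lifts C f g}"


section \<open>The category \<open>FStoch\<close>\<close>

text \<open>
  The objects are the finite subsets of a universe that consists of the elements of an arbitrary
  type and is closed under pairing, so that Cartesian products of objects are again objects.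
\<close>

datatype 'a elem = Point 'a | Star | Pr (pfst: "'a elem") (psnd: "'a elem")

definition cart :: "'a elem set \<Rightarrow> 'a elem set \<Rightarrow> 'a elem set" where
  "cart X Y = {Pr x y |x y. x \<in> X \<and> y \<in> Y}"

text \<open>
  \<open>entry f y x\<close> is the entry in row \<open>y\<close> and column \<open>x\<close>. Entries outside \<open>tgt f \<times> src f\<close>
  are required to be zero, so that equal matrices are equal as elements of the type.
\<close>

datatype 'a fmat =
  FMat (src: "'a elem set") (tgt: "'a elem set") (entry: "'a elem \<Rightarrow> 'a elem \<Rightarrow> real")

definition is_fmat :: "'a fmat \<Rightarrow> bool" where
  "is_fmat f \<longleftrightarrow> finite (src f) \<and> finite (tgt f) \<and> (\<forall>y x. 0 \<le> entry f y x) \<and>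
     (\<forall>y x. \<not> (y \<in> tgt f \<and> x \<in> src f) \<longrightarrow> entry f y x = 0)"

definition mat_comp :: "'a fmat \<Rightarrow> 'a fmat \<Rightarrow> 'a fmat" where
  "mat_comp g f = FMat (src f) (tgt g) (\<lambda>z x. \<Sum>y\<in>tgt f. entry g z y * entry f y x)"

definition kronecker :: "'a fmat \<Rightarrow> 'a fmat \<Rightarrow> 'a fmat" where
  "kronecker f g = FMat (cart (src f) (src g)) (cart (tgt f) (tgt g))
     (\<lambda>q p. case (q, p) of
        (Pr y y', Pr x x') \<Rightarrow> entry f y x * entry g y' x'
      | _ \<Rightarrow> 0)"

text \<open>The 0-1 matrix of a function \<open>\<phi>\<close> from \<open>X\<close> to \<open>Y\<close>.\<close>

definition fun_mat :: "'a elem set \<Rightarrow> 'a elem set \<Rightarrow> ('a elem \<Rightarrow> 'a elem) \<Rightarrow> 'a fmat" where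
  "fun_mat X Y \<phi> = FMat X Y (\<lambda>y x. if x \<in> X \<and> y \<in> Y \<and> y = \<phi> x then 1 else 0)"

definition FStoch :: "('a elem set, 'a fmat) smcat" where
  "FStoch = \<lparr>
     Obj = {X. finite X},
     Arr = {f. is_fmat f},
     Dom = src,
     Cod = tgt,
     Id = (\<lambda>X. fun_mat X X (\<lambda>x. x)),
     Comp = mat_comp,
     TensorO = cart,
     Tensor = kronecker,
     Unit = {Star},
     Assoc = (\<lambda>X Y Z. fun_mat (cart (cart X Y) Z) (cart X (cart Y Z))
       (\<lambda>p. Pr (pfst (pfst p)) (Pr (psnd (pfst p)) (psnd p)))),
     LUnit = (\<lambda>X. fun_mat (cart {Star} X) X psnd),
     RUnit = (\<lambda>X. fun_mat (cart X {Star}) X pfst),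
     Sym = (\<lambda>X Y. fun_mat (cart X Y) (cart Y X) (\<lambda>p. Pr (psnd p) (pfst p)))\<rparr>"

lemma FStoch_sel [simp]:
  "Obj FStoch = {X. finite X}"
  "Arr FStoch = {f. is_fmat f}"
  "Dom FStoch = src"
  "Cod FStoch = tgt"
  "Id FStoch X = fun_mat X X (\<lambda>x. x)"
  "Comp FStoch = mat_comp"
  "TensorO FStoch = cart"
  "Tensor FStoch = kronecker"
  "Unit FStoch = {Star}"
  "Assoc FStoch X Y Z = fun_mat (cart (cart X Y) Z) (cart X (cart Y Z))
       (\<lambda>p. Pr (pfst (pfst p)) (Pr (psnd (pfst p)) (psnd p)))"
  "LUnit FStoch X = fun_mat (cart {Star} X) X psnd"
  "RUnit FStoch X = fun_mat (cart X {Star}) X pfst"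
  "Sym FStoch X Y = fun_mat (cart X Y) (cart Y X) (\<lambda>p. Pr (psnd p) (pfst p))"
  by (simp_all add: FStoch_def)

definition mixed_state :: "'a elem set \<Rightarrow> 'a fmat" where
  "mixed_state A = FMat {Star} A (\<lambda>a i. if a \<in> A \<and> i = Star then 1 else 0)"

definition discard :: "'a elem set \<Rightarrow> 'a fmat" where
  "discard A = FMat A {Star} (\<lambda>i a. if i = Star \<and> a \<in> A then 1 else 0)"

text \<open>
  Only the states and effects of nonempty sets are used as tests. Lifting against the state or
  the effect of the empty set would in addition exclude matrices with a zero column
  (respectively row); see \<open>zero_not_lifting\<close> below.
\<close>

definition mixed_states :: "'a fmat set" where
  "mixed_states = {mixed_state A |A. finite A \<and> A \<noteq> {}}"

definition discards :: "'a fmat set" where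
  "discards = {discard A |A. finite A \<and> A \<noteq> {}}"

definition pure_morphisms :: "'a fmat set" where
  "pure_morphisms = right_lifting_class FStoch mixed_states"

definition copure_morphisms :: "'a fmat set" where
  "copure_morphisms = left_lifting_class FStoch discards"


section \<open>\<open>FStoch\<close> is a symmetric monoidal category\<close>

lemma in_hom_FStoch: "f \<in> hom FStoch X Y \<longleftrightarrow> is_fmat f \<and> src f = X \<and> tgt f = Y"
  by (auto simp: hom_def)

lemma cart_iff [simp]: "Pr x y \<in> cart X Y \<longleftrightarrow> x \<in> X \<and> y \<in> Y"
  by (auto simp: cart_def)

lemma cartE: "p \<in> cart X Y \<Longrightarrow> (\<And>x y. p = Pr x y \<Longrightarrow> x \<in> X \<Longrightarrow> y \<in> Y \<Longrightarrow> P) \<Longrightarrow> P"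
  by (auto simp: cart_def)

lemma ball_cart: "(\<forall>p\<in>cart X Y. P p) \<longleftrightarrow> (\<forall>x\<in>X. \<forall>y\<in>Y. P (Pr x y))"
  by (auto simp: cart_def)

lemma cart_image: "cart X Y = (\<lambda>(x, y). Pr x y) ` (X \<times> Y)"
  by (auto simp: cart_def)

lemma finite_cart [simp]: "finite X \<Longrightarrow> finite Y \<Longrightarrow> finite (cart X Y)"
  by (simp add: cart_image)

lemma sum_cart: "sum F (cart X Y) = (\<Sum>x\<in>X. \<Sum>y\<in>Y. F (Pr x y))"
proof -
  have "sum F (cart X Y) = (\<Sum>(x, y)\<in>X \<times> Y. F (Pr x y))"
    unfolding cart_image by (subst sum.reindex) (auto simp: inj_on_def intro!: sum.cong)
  then show ?thesis by (simp add: sum.cartesian_product)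
qed

lemma fmat_eqI:
  assumes "is_fmat f" "is_fmat g" "src f = src g" "tgt f = tgt g"
    and "\<And>y x. y \<in> tgt g \<Longrightarrow> x \<in> src g \<Longrightarrow> entry f y x = entry g y x"
  shows "f = g"
proof (rule fmat.expand, intro conjI ext)
  fix y x show "entry f y x = entry g y x"
    using assms by (cases "y \<in> tgt g \<and> x \<in> src g") (auto simp: is_fmat_def)
qed (use assms in auto)

lemma src_tgt [simp]:
  "src (mat_comp g f) = src f" "tgt (mat_comp g f) = tgt g"
  "src (kronecker f g) = cart (src f) (src g)" "tgt (kronecker f g) = cart (tgt f) (tgt g)"
  "src (fun_mat X Y \<phi>) = X" "tgt (fun_mat X Y \<phi>) = Y"
  by (simp_all add: mat_comp_def kronecker_def fun_mat_def)

lemma entry_simps: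
  "entry (mat_comp g f) z x = (\<Sum>y\<in>tgt f. entry g z y * entry f y x)"
  "entry (kronecker f g) (Pr y y') (Pr x x') = entry f y x * entry g y' x'"
  "entry (fun_mat X Y \<phi>) y x = (if x \<in> X \<and> y \<in> Y \<and> y = \<phi> x then 1 else 0)"
  by (simp_all add: mat_comp_def kronecker_def fun_mat_def)

lemma is_fmat_comp: "is_fmat f \<Longrightarrow> is_fmat g \<Longrightarrow> is_fmat (mat_comp g f)"
  unfolding is_fmat_def by (auto simp: mat_comp_def intro!: sum_nonneg sum.neutral)

lemma is_fmat_kronecker: "is_fmat f \<Longrightarrow> is_fmat g \<Longrightarrow> is_fmat (kronecker f g)"
  unfolding is_fmat_def kronecker_def by (auto split: elem.splits)

lemma is_fmat_fun_mat: "finite X \<Longrightarrow> finite Y \<Longrightarrow> is_fmat (fun_mat X Y \<phi>)"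
  unfolding is_fmat_def by (auto simp: fun_mat_def)

lemmas is_fmat_intros = is_fmat_comp is_fmat_kronecker is_fmat_fun_mat

lemma is_fmat_finite: "is_fmat f \<Longrightarrow> finite (src f)" "is_fmat f \<Longrightarrow> finite (tgt f)"
  by (simp_all add: is_fmat_def)

lemma fun_mat_cong: "(\<And>x. x \<in> X \<Longrightarrow> \<phi> x = \<psi> x) \<Longrightarrow> fun_mat X Y \<phi> = fun_mat X Y \<psi>"
  by (auto simp: fun_mat_def fun_eq_iff)

lemma fun_mat_comp:
  assumes "finite Y" "\<forall>x\<in>X. \<phi> x \<in> Y"
  shows "mat_comp (fun_mat Y Z \<psi>) (fun_mat X Y \<phi>) = fun_mat X Z (\<lambda>x. \<psi> (\<phi> x))"
proof (rule fmat.expand, intro conjI ext)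
  fix z x
  have "(\<Sum>y\<in>Y. (if y \<in> Y \<and> z \<in> Z \<and> z = \<psi> y then 1 else 0) *
          (if x \<in> X \<and> y \<in> Y \<and> y = \<phi> x then 1 else 0)) =
        (\<Sum>y\<in>Y. if y = \<phi> x then (if x \<in> X \<and> z \<in> Z \<and> z = \<psi> (\<phi> x) then 1 else 0 :: real) else 0)"
    by (rule sum.cong) auto
  also have "\<dots> = (if x \<in> X \<and> z \<in> Z \<and> z = \<psi> (\<phi> x) then 1 else 0)"
    using assms by simp
  finally show "entry (mat_comp (fun_mat Y Z \<psi>) (fun_mat X Y \<phi>)) z x =
      entry (fun_mat X Z (\<lambda>x. \<psi> (\<phi> x))) z x"
    by (simp add: entry_simps)
qed (auto simp: mat_comp_def fun_mat_def)

lemma fun_mat_kronecker: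
  "kronecker (fun_mat X Y \<phi>) (fun_mat X' Y' \<psi>) =
   fun_mat (cart X X') (cart Y Y') (\<lambda>p. Pr (\<phi> (pfst p)) (\<psi> (psnd p)))"
  by (auto simp: kronecker_def fun_mat_def fun_eq_iff split: elem.splits elim!: cartE)

lemma comp_fun_mat_right:
  assumes "finite Y" "x \<in> X" "\<phi> x \<in> Y"
  shows "entry (mat_comp f (fun_mat X Y \<phi>)) z x = entry f z (\<phi> x)"
proof -
  have "entry (mat_comp f (fun_mat X Y \<phi>)) z x = (\<Sum>y\<in>Y. if y = \<phi> x then entry f z y else 0)"
    unfolding entry_simps src_tgt by (rule sum.cong) (use assms in auto)
  then show ?thesis using assms by simp
qed

lemma comp_fun_mat_left:
  assumes "finite (tgt f)" "z \<in> Z" "y \<in> tgt f" "\<And>y'. y' \<in> tgt f \<Longrightarrow> z = \<phi> y' \<longleftrightarrow> y' = y"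
  shows "entry (mat_comp (fun_mat (tgt f) Z \<phi>) f) z x = entry f y x"
proof -
  have "entry (mat_comp (fun_mat (tgt f) Z \<phi>) f) z x =
      (\<Sum>y'\<in>tgt f. if y' = y then entry f y' x else 0)"
    unfolding entry_simps src_tgt by (rule sum.cong) (use assms in auto)
  then show ?thesis using assms by simp
qed

lemma fun_mat_inverse:
  assumes "finite X" "finite Y" "\<And>x. x \<in> X \<Longrightarrow> \<phi> x \<in> Y \<and> \<psi> (\<phi> x) = x"
    "\<And>y. y \<in> Y \<Longrightarrow> \<psi> y \<in> X \<and> \<phi> (\<psi> y) = y"
  shows "inverse_arrows FStoch (fun_mat X Y \<phi>) (fun_mat Y X \<psi>)"
  using assms
  by (auto simp: inverse_arrows_def in_hom_FStoch is_fmat_fun_mat fun_mat_comp intro!: fun_mat_cong)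

lemma structure_arrows_iso:
  assumes "a \<in> structure_arrows FStoch"
  obtains \<phi> \<psi> where "a = fun_mat (src a) (tgt a) \<phi>"
    "inverse_arrows FStoch a (fun_mat (tgt a) (src a) \<psi>)"
proof -
  consider X Y Z where "finite X" "finite Y" "finite Z"
      "a = fun_mat (cart (cart X Y) Z) (cart X (cart Y Z))
        (\<lambda>p. Pr (pfst (pfst p)) (Pr (psnd (pfst p)) (psnd p)))"
    | X where "finite X" "a = fun_mat (cart {Star} X) X psnd"
    | X where "finite X" "a = fun_mat (cart X {Star}) X pfst"
    | X Y where "finite X" "finite Y" "a = fun_mat (cart X Y) (cart Y X) (\<lambda>p. Pr (psnd p) (pfst p))"
    using assms unfolding structure_arrows_def by auto
  then have "\<exists>\<phi> \<psi>. a = fun_mat (src a) (tgt a) \<phi> \<and>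
      inverse_arrows FStoch a (fun_mat (tgt a) (src a) \<psi>)"
  proof cases
    case (1 X Y Z)
    note * = 1(1-3) and a = 1(4)
    have "inverse_arrows FStoch a (fun_mat (tgt a) (src a)
        (\<lambda>p. Pr (Pr (pfst p) (pfst (psnd p))) (psnd (psnd p))))"
      unfolding a src_tgt by (rule fun_mat_inverse) (use * in \<open>auto elim!: cartE\<close>)
    moreover have "a = fun_mat (src a) (tgt a)
        (\<lambda>p. Pr (pfst (pfst p)) (Pr (psnd (pfst p)) (psnd p)))" by (simp add: a)
    ultimately show ?thesis by blast
  next
    case (2 X)
    note * = 2(1) and a = 2(2)
    have "inverse_arrows FStoch a (fun_mat (tgt a) (src a) (Pr Star))"
      unfolding a src_tgt by (rule fun_mat_inverse) (use * in \<open>auto elim!: cartE\<close>)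
    moreover have "a = fun_mat (src a) (tgt a) psnd" by (simp add: a)
    ultimately show ?thesis by blast
  next
    case (3 X)
    note * = 3(1) and a = 3(2)
    have "inverse_arrows FStoch a (fun_mat (tgt a) (src a) (\<lambda>x. Pr x Star))"
      unfolding a src_tgt by (rule fun_mat_inverse) (use * in \<open>auto elim!: cartE\<close>)
    moreover have "a = fun_mat (src a) (tgt a) pfst" by (simp add: a)
    ultimately show ?thesis by blast
  next
    case (4 X Y)
    note * = 4(1,2) and a = 4(3)
    have "inverse_arrows FStoch a (fun_mat (tgt a) (src a) (\<lambda>p. Pr (psnd p) (pfst p)))"
      unfolding a src_tgt by (rule fun_mat_inverse) (use * in \<open>auto elim!: cartE\<close>)
    moreover have "a = fun_mat (src a) (tgt a) (\<lambda>p. Pr (psnd p) (pfst p))" by (simp add: a)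
    ultimately show ?thesis by blast
  qed
  then show ?thesis using that by blast
qed

lemma symmetric_monoidal_FStoch: "symmetric_monoidal_category FStoch"
proof (unfold_locales, goal_cases)
  case (1 f) then show ?case by (simp add: is_fmat_def)
next
  case (2 X) then show ?case by (simp add: in_hom_FStoch is_fmat_fun_mat)
next
  case (3 f X Y g Z) then show ?case by (simp add: in_hom_FStoch is_fmat_comp)
next
  case (4 f X Y)
  then have *: "is_fmat f" "X = src f" "Y = tgt f" by (auto simp: in_hom_FStoch)
  show ?case unfolding FStoch_sel *(2,3)
    by (rule fmat_eqI) (use * in \<open>auto intro: is_fmat_intros is_fmat_finite comp_fun_mat_left\<close>)
next
  case (5 f X Y)
  then have *: "is_fmat f" "X = src f" "Y = tgt f" by (auto simp: in_hom_FStoch)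
  show ?case unfolding FStoch_sel *(2,3)
    by (rule fmat_eqI) (use * in \<open>auto intro: is_fmat_intros is_fmat_finite comp_fun_mat_right\<close>)
next
  case (6 f W X g Y h Z)
  show ?case unfolding FStoch_sel
  proof (rule fmat_eqI)
    fix z w
    have "(\<Sum>x\<in>tgt f. (\<Sum>y\<in>tgt g. entry h z y * entry g y x) * entry f x w) =
        (\<Sum>x\<in>tgt f. \<Sum>y\<in>tgt g. entry h z y * (entry g y x * entry f x w))"
      by (simp add: sum_distrib_right mult.assoc)
    also have "\<dots> = (\<Sum>y\<in>tgt g. \<Sum>x\<in>tgt f. entry h z y * (entry g y x * entry f x w))"
      by (rule sum.swap)
    finally show "entry (mat_comp (mat_comp h g) f) z w = entry (mat_comp h (mat_comp g f)) z w"
      by (simp add: entry_simps sum_distrib_left)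
  qed (use 6 in \<open>auto simp: in_hom_FStoch intro!: is_fmat_intros\<close>)
next
  case 7 then show ?case by simp
next
  case (8 X Y) then show ?case by simp
next
  case (9 f X Y f' X' Y') then show ?case by (simp add: in_hom_FStoch is_fmat_kronecker)
next
  case (10 X Y) then show ?case
    by (auto simp: fun_mat_kronecker intro!: fun_mat_cong elim!: cartE)
next
  case (11 f X Y g Z f' X' Y' g' Z')
  show ?case unfolding FStoch_sel
  proof (rule fmat_eqI)
    fix z x
    assume "z \<in> tgt (mat_comp (kronecker g g') (kronecker f f'))"
      "x \<in> src (mat_comp (kronecker g g') (kronecker f f'))"
    then obtain z1 z2 x1 x2 where "z = Pr z1 z2" "x = Pr x1 x2" by (auto elim!: cartE)
    then show "entry (kronecker (mat_comp g f) (mat_comp g' f')) z x =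
        entry (mat_comp (kronecker g g') (kronecker f f')) z x"
      by (simp add: entry_simps sum_cart sum_product mult_ac) (rule sum.swap)
  qed (use 11 in \<open>auto simp: in_hom_FStoch intro!: is_fmat_intros\<close>)
next
  case (12 X Y Z) then show ?case by (simp add: in_hom_FStoch is_fmat_fun_mat)
next
  case (13 X) then show ?case by (simp add: in_hom_FStoch is_fmat_fun_mat)
next
  case (14 X) then show ?case by (simp add: in_hom_FStoch is_fmat_fun_mat)
next
  case (15 X Y) then show ?case by (simp add: in_hom_FStoch is_fmat_fun_mat)
next
  case (16 a) then show ?case by (metis structure_arrows_iso)
next
  case (17 f X X' g Y Y' h Z Z')
  then have *: "is_fmat f" "is_fmat g" "is_fmat h" "X = src f" "X' = tgt f"
    "Y = src g" "Y' = tgt g" "Z = src h" "Z' = tgt h" by (auto simp: in_hom_FStoch)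
  note fin = *(1-3)[THEN is_fmat_finite(1)] *(1-3)[THEN is_fmat_finite(2)]
  let ?\<phi> = "\<lambda>p. Pr (pfst (pfst p)) (Pr (psnd (pfst p)) (psnd p))"
  show ?case unfolding FStoch_sel *(4-9)
  proof (rule fmat_eqI, goal_cases)
    case (5 y x)
    then obtain y1 y2 y3 x1 x2 x3 where y: "y = Pr y1 (Pr y2 y3)" "y1 \<in> tgt f" "y2 \<in> tgt g" "y3 \<in> tgt h"
      and x: "x = Pr (Pr x1 x2) x3" "x1 \<in> src f" "x2 \<in> src g" "x3 \<in> src h" by (auto elim!: cartE)
    have "entry (mat_comp (fun_mat (tgt (kronecker (kronecker f g) h)) (cart (tgt f) (cart (tgt g) (tgt h))) ?\<phi>)
          (kronecker (kronecker f g) h)) y x = entry (kronecker (kronecker f g) h) (Pr (Pr y1 y2) y3) x"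
      by (rule comp_fun_mat_left) (use fin y in \<open>auto elim!: cartE\<close>)
    moreover have "entry (mat_comp (kronecker f (kronecker g h))
          (fun_mat (cart (cart (src f) (src g)) (src h)) (cart (src f) (cart (src g) (src h))) ?\<phi>)) y x
        = entry (kronecker f (kronecker g h)) y (?\<phi> x)"
      by (rule comp_fun_mat_right) (use fin x in auto)
    ultimately show ?case by (simp add: x y entry_simps)
  qed (use * fin in \<open>auto intro!: is_fmat_intros\<close>)
next
  case (18 f X Y)
  then have *: "is_fmat f" "X = src f" "Y = tgt f" by (auto simp: in_hom_FStoch)
  note fin = is_fmat_finite[OF *(1)]
  let ?I = "fun_mat {Star} {Star} (\<lambda>x. x) :: 'a fmat"
  show ?case unfolding FStoch_sel *(2,3)
  proof (rule fmat_eqI, goal_cases)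
    case (5 y x)
    then obtain x' where x: "x = Pr Star x'" "x' \<in> src f" by (auto elim!: cartE)
    have "entry (mat_comp (fun_mat (tgt (kronecker ?I f)) (tgt f) psnd) (kronecker ?I f)) y x =
        entry (kronecker ?I f) (Pr Star y) x"
      by (rule comp_fun_mat_left) (use fin 5 in \<open>auto elim!: cartE\<close>)
    moreover have "entry (mat_comp f (fun_mat (cart {Star} (src f)) (src f) psnd)) y x = entry f y (psnd x)"
      by (rule comp_fun_mat_right) (use fin x in auto)
    ultimately show ?case by (simp add: x entry_simps)
  qed (use * fin in \<open>auto intro!: is_fmat_intros\<close>)
next
  case (19 f X Y)
  then have *: "is_fmat f" "X = src f" "Y = tgt f" by (auto simp: in_hom_FStoch)
  note fin = is_fmat_finite[OF *(1)]
  let ?I = "fun_mat {Star} {Star} (\<lambda>x. x) :: 'a fmat"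
  show ?case unfolding FStoch_sel *(2,3)
  proof (rule fmat_eqI, goal_cases)
    case (5 y x)
    then obtain x' where x: "x = Pr x' Star" "x' \<in> src f" by (auto elim!: cartE)
    have "entry (mat_comp (fun_mat (tgt (kronecker f ?I)) (tgt f) pfst) (kronecker f ?I)) y x =
        entry (kronecker f ?I) (Pr y Star) x"
      by (rule comp_fun_mat_left) (use fin 5 in \<open>auto elim!: cartE\<close>)
    moreover have "entry (mat_comp f (fun_mat (cart (src f) {Star}) (src f) pfst)) y x = entry f y (pfst x)"
      by (rule comp_fun_mat_right) (use fin x in auto)
    ultimately show ?case by (simp add: x entry_simps)
  qed (use * fin in \<open>auto intro!: is_fmat_intros\<close>)
next
  case (20 f X X' g Y Y')
  then have *: "is_fmat f" "is_fmat g" "X = src f" "X' = tgt f" "Y = src g" "Y' = tgt g"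
    by (auto simp: in_hom_FStoch)
  note fin = *(1,2)[THEN is_fmat_finite(1)] *(1,2)[THEN is_fmat_finite(2)]
  let ?\<phi> = "\<lambda>p. Pr (psnd p) (pfst p)"
  show ?case unfolding FStoch_sel *(3-6)
  proof (rule fmat_eqI, goal_cases)
    case (5 y x)
    then obtain y1 y2 x1 x2 where y: "y = Pr y2 y1" "y1 \<in> tgt f" "y2 \<in> tgt g"
      and x: "x = Pr x1 x2" "x1 \<in> src f" "x2 \<in> src g" by (auto elim!: cartE)
    have "entry (mat_comp (fun_mat (tgt (kronecker f g)) (cart (tgt g) (tgt f)) ?\<phi>)
          (kronecker f g)) y x = entry (kronecker f g) (Pr y1 y2) x"
      by (rule comp_fun_mat_left) (use fin y in \<open>auto elim!: cartE\<close>)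
    moreover have "entry (mat_comp (kronecker g f)
          (fun_mat (cart (src f) (src g)) (cart (src g) (src f)) ?\<phi>)) y x
        = entry (kronecker g f) y (?\<phi> x)"
      by (rule comp_fun_mat_right) (use fin x in auto)
    ultimately show ?case by (simp add: x y entry_simps)
  qed (use * fin in \<open>auto intro!: is_fmat_intros\<close>)
next
  case (21 W X Y Z) then show ?case
    by (auto simp: fun_mat_kronecker fun_mat_comp ball_cart intro!: fun_mat_cong elim!: cartE)
next
  case (22 X Y) then show ?case
    by (auto simp: fun_mat_kronecker fun_mat_comp ball_cart intro!: fun_mat_cong elim!: cartE)
next
  case (23 X Y) then show ?case
    by (auto simp: fun_mat_kronecker fun_mat_comp ball_cart intro!: fun_mat_cong elim!: cartE)
next
  case (24 X Y Z) then show ?case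
    by (auto simp: fun_mat_kronecker fun_mat_comp ball_cart intro!: fun_mat_cong elim!: cartE)
qed


section \<open>The empty set as a test object\<close>

text \<open>
  The zero column \<open>{Star} \<rightarrow> {}\<close> has at most one nonzero entry in its only column, and the zero
  row \<open>{} \<rightarrow> {Star}\<close> has at most one nonzero entry in its only row.
\<close>

lemma zero_not_lifting:
  fixes zc zr :: "'a fmat"
  defines "zc \<equiv> FMat {Star} {} (\<lambda>_ _. 0)" and "zr \<equiv> FMat {} {Star} (\<lambda>_ _. 0)"
  shows "\<not> tensor_lifts FStoch (mixed_state {}) zc"
    and "\<not> tensor_lifts FStoch zr (discard {})"
proof -
  let ?I = "fun_mat {Star} {Star} (\<lambda>x. x) :: 'a fmat"
  let ?J = "kronecker ?I ?I"
  have ends: "src zc = {Star}" "tgt zc = {}" "src zr = {}" "tgt zr = {Star}"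
    "src (mixed_state {} :: 'a fmat) = {Star}" "tgt (mixed_state {} :: 'a fmat) = {}"
    "src (discard {} :: 'a fmat) = {}" "tgt (discard {} :: 'a fmat) = {Star}"
    by (simp_all add: zc_def zr_def mixed_state_def discard_def)
  have empty: "cart {} X = {}" for X :: "'a elem set" by (auto simp: cart_def)
  have J: "is_fmat ?J" by (intro is_fmat_intros) auto
  have J1: "entry ?J (Pr Star Star) (Pr Star Star) = 1" by (simp add: entry_simps)
  have F: "is_fmat (FMat (cart {} {Star}) (cart {} {Star}) (\<lambda>_ _. 0) :: 'a fmat)"
    by (simp add: is_fmat_def)
  have W: "is_fmat zc" "is_fmat zr" "is_fmat (mixed_state {} :: 'a fmat)" "is_fmat (discard {} :: 'a fmat)"
    by (auto simp: is_fmat_def zc_def zr_def mixed_state_def discard_def)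
  show "\<not> tensor_lifts FStoch (mixed_state {}) zc"
  proof
    let ?f = "kronecker (mixed_state {}) ?I" and ?g = "kronecker zc ?I"
    let ?v = "FMat (cart {} {Star}) (cart {} {Star}) (\<lambda>_ _. 0) :: 'a fmat"
    assume "tensor_lifts FStoch (mixed_state {}) zc"
    then have L: "lifts FStoch ?f ?g" by (simp add: tensor_lifts_def)
    have "mat_comp ?g ?J = mat_comp ?v ?f"
      by (rule fmat_eqI) (use J F W in \<open>auto simp: ends empty intro!: is_fmat_intros\<close>)
    moreover have "?J \<in> hom FStoch (src ?f) (src ?g)" "?v \<in> hom FStoch (tgt ?f) (tgt ?g)"
      using J F by (simp_all add: in_hom_FStoch ends)
    ultimately obtain h where "mat_comp h ?f = ?J"
      using L unfolding lifts_def FStoch_sel by blast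
    then have "entry ?J (Pr Star Star) (Pr Star Star) = 0"
      by (metis (no_types, lifting) empty ends(6) entry_simps(1) src_tgt(4) sum.empty)
    then show False using J1 by simp
  qed
  show "\<not> tensor_lifts FStoch zr (discard {})"
  proof
    let ?f = "kronecker zr ?I" and ?g = "kronecker (discard {}) ?I"
    let ?u = "FMat (cart {} {Star}) (cart {} {Star}) (\<lambda>_ _. 0) :: 'a fmat"
    assume "tensor_lifts FStoch zr (discard {})"
    then have L: "lifts FStoch ?f ?g" by (simp add: tensor_lifts_def)
    have "mat_comp ?g ?u = mat_comp ?J ?f"
      by (rule fmat_eqI) (use J F W in \<open>auto simp: ends empty intro!: is_fmat_intros\<close>)
    moreover have "?u \<in> hom FStoch (src ?f) (src ?g)" "?J \<in> hom FStoch (tgt ?f) (tgt ?g)"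
      using J F by (simp_all add: in_hom_FStoch ends)
    ultimately obtain h where "h \<in> hom FStoch (tgt ?f) (src ?g)" "mat_comp ?g h = ?J"
      using L unfolding lifts_def FStoch_sel by blast
    then have "entry ?J (Pr Star Star) (Pr Star Star) = 0"
      by (metis (no_types, lifting) empty ends(7) entry_simps(1) in_hom_FStoch src_tgt(3) sum.empty)
    then show False using J1 by simp
  qed
qed

end

theory Submission
  imports Defs
begin

text \<open>
  A lifting problem of \<open>\<mu>\<^sub>A \<otimes> id\<close> against \<open>g \<otimes> id\<close> asks to distribute each entry of \<open>u\<close> over
  the index \<open>a \<in> A\<close> so that the result is mapped to \<open>v\<close> by \<open>g\<close>. If column \<open>c\<close> of \<open>g\<close> has its
  only nonzero entry in row \<open>d\<close>, distributing proportionally to row \<open>d\<close> of \<open>v\<close> works; for a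
  zero column any distribution does, which is where \<open>A \<noteq> {}\<close> enters. Conversely,
  let \<open>u\<close> be the \<open>c\<close>-th unit vector, \<open>A\<close> the codomain of \<open>g\<close> and \<open>v\<close> the diagonal matrix of column
  \<open>c\<close>: a solution splits \<open>1\<close> into weights \<open>t\<^sub>a\<close> such that \<open>t\<^sub>a\<close> times column \<open>c\<close> is supported in
  row \<open>a\<close> and agrees with column \<open>c\<close> there, which is impossible when the column has two nonzero
  entries. Transposition exchanges \<open>\<mu>\<^sub>A\<close> with \<open>\<epsilon>\<^sub>A\<close> and the two sides of a lifting problem, so the
  copure morphisms are the transposes of the pure ones.
\<close>

section \<open>Supports of columns\<close>

text \<open>The row condition has no name of its own; it is expressed as
  \<open>column_monomial (transpose_fmat f)\<close>.\<close>

definition column_monomial :: "'a fmat \<Rightarrow> bool" where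
  "column_monomial f \<longleftrightarrow> (\<forall>x\<in>src f. \<exists>\<^sub>\<le>\<^sub>1 y. y \<in> tgt f \<and> entry f y x \<noteq> 0)"

definition transpose_fmat :: "'a fmat \<Rightarrow> 'a fmat" where
  "transpose_fmat f = FMat (tgt f) (src f) (\<lambda>x y. entry f y x)"

lemma is_fmat_entryD:
  assumes "is_fmat f" "entry f y x \<noteq> 0"
  shows "y \<in> tgt f" "x \<in> src f"
  using assms by (auto simp: is_fmat_def)

lemma is_fmat_nonneg: "is_fmat f \<Longrightarrow> 0 \<le> entry f y x"
  by (simp add: is_fmat_def)

lemma column_monomial_iff:
  assumes "is_fmat f"
  shows "column_monomial f \<longleftrightarrow>
    (\<forall>x y y'. entry f y x \<noteq> 0 \<longrightarrow> entry f y' x \<noteq> 0 \<longrightarrow> y = y')"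
  using is_fmat_entryD[OF assms] unfolding column_monomial_def Uniq_def by metis

lemma mixed_state_sel [simp]:
  "src (mixed_state A) = {Star}" "tgt (mixed_state A) = A"
  "entry (mixed_state A) a i = (if a \<in> A \<and> i = Star then 1 else 0)"
  by (simp_all add: mixed_state_def)

lemma is_fmat_mixed_state: "finite A \<Longrightarrow> is_fmat (mixed_state A)"
  by (auto simp: is_fmat_def)


section \<open>Transposition\<close>

lemma transpose_sel [simp]:
  "src (transpose_fmat f) = tgt f" "tgt (transpose_fmat f) = src f"
  "entry (transpose_fmat f) x y = entry f y x"
  by (simp_all add: transpose_fmat_def)

lemma transpose_transpose [simp]: "transpose_fmat (transpose_fmat f) = f"
  by (simp add: transpose_fmat_def)

lemma is_fmat_transpose [simp]: "is_fmat (transpose_fmat f) \<longleftrightarrow> is_fmat f"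
  by (auto simp: is_fmat_def)

lemma transpose_hom: "transpose_fmat f \<in> hom FStoch X Y \<longleftrightarrow> f \<in> hom FStoch Y X"
  by (auto simp: in_hom_FStoch)

text \<open>\<open>mat_comp\<close> sums over the target of its right factor, which is
  \<open>tgt f\<close> on one side and \<open>src g\<close> on the other; the premise makes them
  agree.\<close>

lemma transpose_comp:
  "tgt f = src g \<Longrightarrow> transpose_fmat (mat_comp g f) = mat_comp (transpose_fmat f) (transpose_fmat g)"
  by (simp add: transpose_fmat_def mat_comp_def mult.commute)

lemma transpose_kronecker:
  "transpose_fmat (kronecker f g) = kronecker (transpose_fmat f) (transpose_fmat g)"
  by (auto simp: transpose_fmat_def kronecker_def fun_eq_iff split: elem.splits)

lemma transpose_id [simp]: "transpose_fmat (fun_mat X X (\<lambda>x. x)) = fun_mat X X (\<lambda>x. x)"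
  by (auto simp: transpose_fmat_def fun_mat_def fun_eq_iff)

lemma transpose_discard [simp]: "transpose_fmat (discard A) = mixed_state A"
  by (auto simp: transpose_fmat_def discard_def mixed_state_def fun_eq_iff)

text \<open>Transposing a commuting square turns its top edge into the bottom one and vice versa;
  the transpose of the diagonal of the new square fills the old one.\<close>

lemma lifts_transposeI:
  assumes "lifts FStoch f g"
  shows "lifts FStoch (transpose_fmat g) (transpose_fmat f)"
  unfolding lifts_def FStoch_sel transpose_sel
proof (intro ballI impI)
  fix u v
  assume u: "u \<in> hom FStoch (tgt g) (tgt f)" and v: "v \<in> hom FStoch (src g) (src f)"
    and eq: "mat_comp (transpose_fmat f) u = mat_comp v (transpose_fmat g)"
  have "mat_comp g (transpose_fmat v) = mat_comp (transpose_fmat u) f"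
    using arg_cong[OF eq, of transpose_fmat] u v by (simp add: transpose_comp in_hom_FStoch)
  then obtain h where h: "h \<in> hom FStoch (tgt f) (src g)"
    "mat_comp h f = transpose_fmat v" "mat_comp g h = transpose_fmat u"
    using assms u v unfolding lifts_def FStoch_sel by (metis transpose_hom)
  have "transpose_fmat h \<in> hom FStoch (src g) (tgt f)"
    "mat_comp (transpose_fmat h) (transpose_fmat g) = u"
    "mat_comp (transpose_fmat f) (transpose_fmat h) = v"
    using h(1) arg_cong[OF h(2), of transpose_fmat] arg_cong[OF h(3), of transpose_fmat]
    by (simp_all add: transpose_hom transpose_comp in_hom_FStoch)
  then show "\<exists>h\<in>hom FStoch (src g) (tgt f). mat_comp h (transpose_fmat g) = u \<and>
      mat_comp (transpose_fmat f) h = v" by blast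
qed

lemma lifts_transpose:
  "lifts FStoch (transpose_fmat g) (transpose_fmat f) \<longleftrightarrow> lifts FStoch f g"
  using lifts_transposeI[of f g] lifts_transposeI[of "transpose_fmat g" "transpose_fmat f"] by auto

text \<open>Identities are their own transposes, so the two tensored objects merely exchange
  roles.\<close>

lemma tensor_lifts_transpose:
  "tensor_lifts FStoch (transpose_fmat g) (transpose_fmat f) \<longleftrightarrow> tensor_lifts FStoch f g"
proof -
  have "lifts FStoch (kronecker (transpose_fmat g) (fun_mat A A (\<lambda>x. x)))
      (kronecker (transpose_fmat f) (fun_mat B B (\<lambda>x. x))) \<longleftrightarrow>
    lifts FStoch (kronecker f (fun_mat B B (\<lambda>x. x))) (kronecker g (fun_mat A A (\<lambda>x. x)))" for A B
    by (subst lifts_transpose[symmetric]) (simp add: transpose_kronecker)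
  then show ?thesis unfolding tensor_lifts_def FStoch_sel by blast
qed

lemma copure_iff_transpose_pure:
  "f \<in> copure_morphisms \<longleftrightarrow> transpose_fmat f \<in> pure_morphisms"
proof -
  have "tensor_lifts FStoch f (discard A) \<longleftrightarrow>
      tensor_lifts FStoch (mixed_state A) (transpose_fmat f)" for A
    using tensor_lifts_transpose[of "discard A" f] by simp
  then show ?thesis
    unfolding copure_morphisms_def pure_morphisms_def left_lifting_class_def
      right_lifting_class_def discards_def mixed_states_def by auto
qed


section \<open>Lifting against completely mixed states\<close>

text \<open>The identity factor keeps only the terms with second index \<open>b\<close>. The
  arbitrary weight \<open>F\<close> stands for a column of whichever matrix is composed with
  \<open>g \<otimes> id\<close>.\<close>

lemma entry_comp_kronecker_id:
  assumes "finite (src g)" "finite B" "b \<in> B"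
  shows "(\<Sum>q\<in>cart (src g) B. entry (kronecker g (fun_mat B B (\<lambda>x. x))) (Pr d b) q * F q) =
    (\<Sum>c\<in>src g. entry g d c * F (Pr c b))"
proof -
  have "(\<Sum>b'\<in>B. entry (kronecker g (fun_mat B B (\<lambda>x. x))) (Pr d b) (Pr c b') * F (Pr c b')) =
      (\<Sum>b'\<in>B. if b = b' then entry g d c * F (Pr c b) else 0)" for c
    by (rule sum.cong) (use assms in \<open>auto simp: entry_simps\<close>)
  then show ?thesis using assms by (simp add: sum_cart)
qed

text \<open>Precomposition with \<open>\<mu>\<^sub>A \<otimes> id\<close> sums a row
  \<open>F\<close> over \<open>A\<close> and leaves the other index alone.\<close>

lemma entry_comp_mixed_state_id:
  assumes "finite A" "finite B" "b \<in> B"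
  shows "(\<Sum>p\<in>cart A B. F p * entry (kronecker (mixed_state A) (fun_mat B B (\<lambda>x. x))) p (Pr Star b)) =
    (\<Sum>a\<in>A. F (Pr a b))"
proof -
  have "(\<Sum>b'\<in>B. F (Pr a b') * entry (kronecker (mixed_state A) (fun_mat B B (\<lambda>x. x))) (Pr a b') (Pr Star b)) =
      (\<Sum>b'\<in>B. if b' = b then F (Pr a b) else 0)" if "a \<in> A" for a
    by (rule sum.cong) (use assms that in \<open>auto simp: entry_simps\<close>)
  then show ?thesis using assms by (simp add: sum_cart)
qed

lemma column_monomial_lifts:
  fixes g :: "'a fmat"
  assumes g: "is_fmat g" "column_monomial g" and A: "finite A" "A \<noteq> {}"
    and A': "finite A'" and B': "finite B'"
  shows "lifts FStoch (kronecker (mixed_state A) (fun_mat A' A' (\<lambda>x. x)))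
    (kronecker g (fun_mat B' B' (\<lambda>x. x)))"
    (is "lifts FStoch ?f ?g")
  unfolding lifts_def
proof (intro ballI impI)
  fix u v
  assume "u \<in> hom FStoch (Dom FStoch ?f) (Dom FStoch ?g)"
    and "v \<in> hom FStoch (Cod FStoch ?f) (Cod FStoch ?g)"
    and eq: "Comp FStoch ?g u = Comp FStoch v ?f"
  then have u: "is_fmat u" "src u = cart {Star} A'" "tgt u = cart (src g) B'"
    and v: "is_fmat v" "src v = cart A A'" "tgt v = cart (tgt g) B'"
    by (simp_all add: in_hom_FStoch)
  have fin: "finite (src g)" "finite (tgt g)" using g by (simp_all add: is_fmat_finite)
  \<comment> \<open>For a zero column any \<open>d\<close> will do, so \<phi> is total.\<close>
  have "\<exists>d. \<forall>d'. entry g d' c \<noteq> 0 \<longrightarrow> d' = d" for c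
    using g column_monomial_iff by metis
  then obtain \<phi> where \<phi>: "\<And>c d. entry g d c \<noteq> 0 \<Longrightarrow> d = \<phi> c" by metis
  \<comment> \<open>The normalising constant of the distribution. Commutativity of the square
    identifies it with an entry of \<open>(g \<otimes> id) \<circ> u\<close>.\<close>
  define s where "s d b a' = (\<Sum>a\<in>A. entry v (Pr d b) (Pr a a'))" for d b a'
  have s: "(\<Sum>c\<in>src g. entry g d c * entry u (Pr c b) (Pr Star a')) = s d b a'"
    if "b \<in> B'" "a' \<in> A'" for d b a'
    using arg_cong[OF eq, of "\<lambda>m. entry m (Pr d b) (Pr Star a')"] that fin A A' B'
    by (simp add: entry_simps(1) u(3) entry_comp_kronecker_id entry_comp_mixed_state_id s_def)
  \<comment> \<open>A vanishing sum of nonnegative terms has only zero terms. This and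
    \<open>u0\<close> make the value 0 of a quotient by 0 correct wherever \<open>s\<close>
    vanishes.\<close>
  have v0: "entry v (Pr d b) (Pr a a') = 0" if "s d b a' = 0" "a \<in> A" for d b a a'
    using that A unfolding s_def by (simp add: sum_nonneg_eq_0_iff is_fmat_nonneg[OF v(1)])
  have u0: "entry g d c * entry u (Pr c b) (Pr Star a') = 0"
    if "s d b a' = 0" "c \<in> src g" "b \<in> B'" "a' \<in> A'" for d c b a'
  proof -
    have "(\<Sum>c\<in>src g. entry g d c * entry u (Pr c b) (Pr Star a')) = 0"
      using s that by simp
    then show ?thesis
      using that(2) fin by (subst (asm) sum_nonneg_eq_0_iff) (auto simp: is_fmat_nonneg g(1) u(1))
  qed
  have s_nonneg: "0 \<le> s d b a'" for d b a'
    unfolding s_def by (intro sum_nonneg is_fmat_nonneg v)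
  \<comment> \<open>The part of the entry of \<open>u\<close> assigned to \<open>a\<close>: uniform
    over \<open>A\<close> for a zero column, otherwise proportional to row \<open>\<phi> c\<close>
    of \<open>v\<close>.\<close>
  define w where "w c b a a' = entry u (Pr c b) (Pr Star a') *
    (if entry g (\<phi> c) c = 0 then 1 / real (card A)
     else entry v (Pr (\<phi> c) b) (Pr a a') / s (\<phi> c) b a')" for c b a a'
  define h where "h = FMat (cart A A') (cart (src g) B')
    (\<lambda>q p. if q \<in> cart (src g) B' \<and> p \<in> cart A A' then w (pfst q) (psnd q) (pfst p) (psnd p) else 0)"
  have h_sel [simp]: "src h = cart A A'" "tgt h = cart (src g) B'"
    and h_entry: "\<And>c b a a'. c \<in> src g \<Longrightarrow> b \<in> B' \<Longrightarrow> a \<in> A \<Longrightarrow> a' \<in> A' \<Longrightarrow>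
      entry h (Pr c b) (Pr a a') = w c b a a'"
    by (simp_all add: h_def)
  have h: "is_fmat h"
    unfolding is_fmat_def using fin A A' B' s_nonneg
    by (auto simp: h_def w_def is_fmat_nonneg u(1) v(1))
  have sum_w: "(\<Sum>a\<in>A. w c b a a') = entry u (Pr c b) (Pr Star a')"
    if c: "c \<in> src g" and b: "b \<in> B'" and a': "a' \<in> A'" for c b a'
  proof (cases "entry g (\<phi> c) c = 0")
    case True
    then show ?thesis using A by (simp add: w_def)
  next
    case False
    have "(\<Sum>a\<in>A. w c b a a') = entry u (Pr c b) (Pr Star a') * (s (\<phi> c) b a' / s (\<phi> c) b a')"
      unfolding w_def using False
      by (simp add: sum_distrib_left[symmetric] sum_divide_distrib[symmetric] s_def[symmetric])
    also have "\<dots> = entry u (Pr c b) (Pr Star a')"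
      using u0[OF _ c b a', of "\<phi> c"] False by (cases "s (\<phi> c) b a' = 0") auto
    finally show ?thesis .
  qed
  have sum_gw: "(\<Sum>c\<in>src g. entry g d c * w c b a a') = entry v (Pr d b) (Pr a a')"
    if a: "a \<in> A" and b: "b \<in> B'" and a': "a' \<in> A'" for d b a a'
  proof -
    \<comment> \<open>Only columns with \<open>\<phi> c = d\<close> contribute, so the quotient does
      not depend on \<open>c\<close> and can be pulled out of the sum.\<close>
    have "(\<Sum>c\<in>src g. entry g d c * w c b a a') =
        (\<Sum>c\<in>src g. entry g d c * entry u (Pr c b) (Pr Star a') *
          (entry v (Pr d b) (Pr a a') / s d b a'))"
    proof (rule sum.cong[OF refl])
      fix c
      show "entry g d c * w c b a a' = entry g d c * entry u (Pr c b) (Pr Star a') *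
          (entry v (Pr d b) (Pr a a') / s d b a')"
        using \<phi>[of d c] by (cases "entry g d c = 0") (auto simp: w_def)
    qed
    also have "\<dots> = s d b a' * (entry v (Pr d b) (Pr a a') / s d b a')"
      by (simp only: sum_distrib_right[symmetric] s[OF b a'])
    also have "\<dots> = entry v (Pr d b) (Pr a a')"
      using v0[OF _ a, of d b a'] by (cases "s d b a' = 0") auto
    finally show ?thesis .
  qed
  have "mat_comp h ?f = u"
  proof (rule fmat_eqI, goal_cases)
    case (5 q p)
    then obtain c b a' where "q = Pr c b" "p = Pr Star a'" "c \<in> src g" "b \<in> B'" "a' \<in> A'"
      by (auto simp: u elim!: cartE)
    then show ?case
      using A A' by (simp add: entry_simps(1) entry_comp_mixed_state_id h_entry sum_w)
  qed (use h u A A' in \<open>auto intro!: is_fmat_intros is_fmat_mixed_state\<close>)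
  moreover have "mat_comp ?g h = v"
  proof (rule fmat_eqI, goal_cases)
    case (5 q p)
    then obtain d b a a' where "q = Pr d b" "p = Pr a a'" "d \<in> tgt g" "b \<in> B'" "a \<in> A" "a' \<in> A'"
      by (auto simp: v elim!: cartE)
    then show ?case
      using fin B' by (simp add: entry_simps(1) entry_comp_kronecker_id h_entry sum_gw)
  qed (use h v g B' in \<open>auto intro!: is_fmat_intros\<close>)
  moreover have "h \<in> hom FStoch (Cod FStoch ?f) (Dom FStoch ?g)"
    using h by (simp add: in_hom_FStoch)
  ultimately show "\<exists>h\<in>hom FStoch (Cod FStoch ?f) (Dom FStoch ?g).
      Comp FStoch h ?f = u \<and> Comp FStoch ?g h = v" by auto
qed

text \<open>The guard on the premise matches the restriction of the tests to nonempty sets; a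
  nonzero entry of \<open>g\<close> discharges it.\<close>

lemma tensor_lifts_imp_column_monomial:
  fixes g :: "'a fmat"
  assumes g: "is_fmat g" and lift: "tgt g \<noteq> {} \<Longrightarrow> tensor_lifts FStoch (mixed_state (tgt g)) g"
  shows "column_monomial g"
  unfolding column_monomial_iff[OF g]
proof (intro allI impI, rule ccontr)
  fix c d d'
  assume d: "entry g d c \<noteq> 0" and d': "entry g d' c \<noteq> 0" and neq: "d \<noteq> d'"
  note mem = is_fmat_entryD[OF g d] is_fmat_entryD[OF g d']
  have fin: "finite (src g)" "finite (tgt g)" using g by (simp_all add: is_fmat_finite)
  \<comment> \<open>Both sides are tensored with the unit, hence the trailing \<open>Star\<close> in
    the indices.\<close>
  define I where "I = (fun_mat {Star} {Star} (\<lambda>x. x) :: 'a fmat)"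
  let ?f = "kronecker (mixed_state (tgt g)) I" and ?g = "kronecker g I"
  define u where "u = (FMat (cart {Star} {Star}) (cart (src g) {Star})
    (\<lambda>q p. if q = Pr c Star \<and> p = Pr Star Star then 1 else 0) :: 'a fmat)"
  define v where "v = (FMat (cart (tgt g) {Star}) (cart (tgt g) {Star})
    (\<lambda>q p. if q = p \<and> p \<in> cart (tgt g) {Star} then entry g (pfst p) c else 0) :: 'a fmat)"
  have sel [simp]: "src u = cart {Star} {Star}" "tgt u = cart (src g) {Star}"
    "src v = cart (tgt g) {Star}" "tgt v = cart (tgt g) {Star}" "src I = {Star}" "tgt I = {Star}"
    by (simp_all add: u_def v_def I_def)
  have u: "is_fmat u" and v: "is_fmat v" and I: "is_fmat I"
    using fin mem by (auto simp: is_fmat_def u_def v_def I_def fun_mat_def is_fmat_nonneg[OF g])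
  \<comment> \<open>Both composites are column \<open>c\<close> of \<open>g\<close>: as the image of
    a unit vector, and as the row sums of a diagonal matrix.\<close>
  have "mat_comp ?g u = mat_comp v ?f"
  proof (rule fmat_eqI, goal_cases)
    case (5 q p)
    then obtain e where e: "q = Pr e Star" "p = Pr Star Star" "e \<in> tgt g"
      by (auto elim!: cartE)
    have "(\<Sum>c'\<in>src g. entry g e c' * entry u (Pr c' Star) (Pr Star Star)) =
        (\<Sum>c'\<in>src g. if c' = c then entry g e c else 0)"
      by (rule sum.cong) (auto simp: u_def)
    moreover have "(\<Sum>a\<in>tgt g. entry v (Pr e Star) (Pr a Star)) =
        (\<Sum>a\<in>tgt g. if a = e then entry g e c else 0)"
      by (rule sum.cong) (use e in \<open>auto simp: v_def\<close>)
    ultimately show ?case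
      using fin mem e
      by (simp add: entry_simps(1) I_def entry_comp_kronecker_id entry_comp_mixed_state_id)
  qed (use u v I g fin in \<open>auto intro!: is_fmat_intros is_fmat_mixed_state\<close>)
  moreover have "lifts FStoch ?f ?g"
    using lift mem(1) unfolding tensor_lifts_def FStoch_sel I_def by blast
  moreover have "u \<in> hom FStoch (src ?f) (src ?g)" "v \<in> hom FStoch (tgt ?f) (tgt ?g)"
    using u v by (simp_all add: in_hom_FStoch)
  ultimately obtain h where h: "h \<in> hom FStoch (tgt ?f) (src ?g)"
    and hf: "mat_comp h ?f = u" and gh: "mat_comp ?g h = v"
    unfolding lifts_def FStoch_sel by blast
  have h': "is_fmat h" "src h = cart (tgt g) {Star}" "tgt h = cart (src g) {Star}"
    using h by (simp_all add: in_hom_FStoch)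
  \<comment> \<open>Row \<open>c'\<close> of \<open>h\<close> has sum 0 because \<open>u\<close>
    vanishes there, and its entries are nonnegative. Hence only column \<open>c\<close> of
    \<open>g\<close> enters the product with \<open>h\<close>.\<close>
  have h0: "entry h (Pr c' Star) (Pr a Star) = 0" if "c' \<noteq> c" "a \<in> tgt g" for c' a
  proof -
    have "(\<Sum>a\<in>tgt g. entry h (Pr c' Star) (Pr a Star)) = 0"
      using arg_cong[OF hf, of "\<lambda>m. entry m (Pr c' Star) (Pr Star Star)"] that fin
      by (simp add: entry_simps(1) I_def entry_comp_mixed_state_id) (simp add: u_def)
    then show ?thesis
      using that fin by (simp add: sum_nonneg_eq_0_iff is_fmat_nonneg[OF h'(1)])
  qed
  have gh_entry: "entry g e c * entry h (Pr c Star) (Pr a Star) = (if e = a then entry g a c else 0)"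
    if "a \<in> tgt g" "e \<in> tgt g" for a e
  proof -
    have "(\<Sum>c'\<in>src g. entry g e c' * entry h (Pr c' Star) (Pr a Star)) =
        (\<Sum>c'\<in>src g. if c' = c then entry g e c * entry h (Pr c Star) (Pr a Star) else 0)"
      by (rule sum.cong) (use h0 that in auto)
    then have "entry (mat_comp ?g h) (Pr e Star) (Pr a Star) =
        entry g e c * entry h (Pr c Star) (Pr a Star)"
      using fin mem that by (simp add: entry_simps(1) I_def entry_comp_kronecker_id h'(3))
    moreover have "entry v (Pr e Star) (Pr a Star) = (if e = a then entry g a c else 0)"
      using that by (auto simp: v_def)
    ultimately show ?thesis by (simp only: gh)
  qed
  \<comment> \<open>The weight at \<open>d\<close> is 1 by the diagonal entry and 0 by the entry in
    row \<open>d'\<close>.\<close>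
  show False using gh_entry[of d d] gh_entry[of d d'] mem d d' neq by simp
qed

lemma pure_morphisms_eq: "pure_morphisms = {f. is_fmat f \<and> column_monomial f}"
proof (rule set_eqI)
  fix g :: "'a fmat"
  have "g \<in> pure_morphisms \<longleftrightarrow> is_fmat g \<and>
      (\<forall>A. finite A \<and> A \<noteq> {} \<longrightarrow> tensor_lifts FStoch (mixed_state A) g)"
    by (auto simp: pure_morphisms_def right_lifting_class_def mixed_states_def)
  also have "\<dots> \<longleftrightarrow> is_fmat g \<and> column_monomial g"
    using tensor_lifts_imp_column_monomial[of g] column_monomial_lifts[of g]
    by (auto simp: tensor_lifts_def is_fmat_finite)
  finally show "g \<in> pure_morphisms \<longleftrightarrow> g \<in> {f. is_fmat f \<and> column_monomial f}" by simp
qed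


section \<open>Closure properties\<close>

text \<open>A nonzero entry of the product passes through some \<open>y\<close>; the column index
  determines \<open>y\<close>, which in turn determines the row.\<close>

lemma column_monomial_comp:
  assumes "is_fmat f" "is_fmat g" "column_monomial f" "column_monomial g"
  shows "column_monomial (mat_comp g f)"
proof -
  have "\<exists>y. entry g z y \<noteq> 0 \<and> entry f y x \<noteq> 0" if "entry (mat_comp g f) z x \<noteq> 0" for z x
    using that unfolding entry_simps
    by (rule sum.not_neutral_contains_not_neutral) auto
  then show ?thesis
    using assms unfolding column_monomial_iff[OF assms(1)] column_monomial_iff[OF assms(2)]
      column_monomial_iff[OF is_fmat_comp[OF assms(1,2)]] by metis
qed

lemma column_monomial_kronecker:
  assumes "is_fmat f" "is_fmat g" "column_monomial f" "column_monomial g"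
  shows "column_monomial (kronecker f g)"
  using assms unfolding column_monomial_iff[OF assms(1)] column_monomial_iff[OF assms(2)]
      column_monomial_iff[OF is_fmat_kronecker[OF assms(1,2)]]
  by (auto simp: kronecker_def split: elem.splits)

lemma column_monomial_fun_mat: "column_monomial (fun_mat X Y \<phi>)"
  by (auto simp: column_monomial_def Uniq_def entry_simps)

text \<open>If \<open>entry f y x\<close> is nonzero, the diagonal entry 1 of
  \<open>g \<circ> f\<close> at \<open>x\<close> must come from this only nonzero entry in column
  \<open>x\<close>, so \<open>entry g x y\<close> is nonzero. Thus the support of row
  \<open>y\<close> of \<open>f\<close> lies in that of column \<open>y\<close> of
  \<open>g\<close>.\<close>

lemma column_monomial_transpose_left_inverse:
  assumes f: "is_fmat f" "column_monomial f" and g: "is_fmat g" "column_monomial g"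
    and inv: "mat_comp g f = fun_mat (src f) (src f) (\<lambda>x. x)"
  shows "column_monomial (transpose_fmat f)"
proof -
  have "entry g x y \<noteq> 0" if nz: "entry f y x \<noteq> 0" for x y
  proof -
    have "entry (mat_comp g f) x x \<noteq> 0"
      using is_fmat_entryD[OF f(1) nz] by (simp add: inv entry_simps)
    then obtain y' where "entry g x y' \<noteq> 0" "entry f y' x \<noteq> 0"
      unfolding entry_simps by (rule sum.not_neutral_contains_not_neutral) auto
    then show ?thesis using nz f by (metis column_monomial_iff)
  qed
  then show ?thesis
    using f g by (simp add: column_monomial_iff) blast
qed

text \<open>The arrow and its inverse are both matrices of functions and left inverses of each
  other, which gives the row condition for both.\<close>

lemma structure_arrows_monomial:
  assumes "a \<in> structure_arrows FStoch"
  obtains b where "inverse_arrows FStoch a b"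
    "column_monomial a" "column_monomial (transpose_fmat a)"
    "column_monomial b" "column_monomial (transpose_fmat b)"
proof -
  obtain \<phi> \<psi> where a: "a = fun_mat (src a) (tgt a) \<phi>"
    and inv: "inverse_arrows FStoch a (fun_mat (tgt a) (src a) \<psi>)"
    using structure_arrows_iso[OF assms] .
  let ?b = "fun_mat (tgt a) (src a) \<psi>"
  have fmat: "is_fmat a" "is_fmat ?b"
    and comp: "mat_comp ?b a = fun_mat (src a) (src a) (\<lambda>x. x)"
      "mat_comp a ?b = fun_mat (tgt a) (tgt a) (\<lambda>x. x)"
    using inv by (simp_all add: inverse_arrows_def in_hom_FStoch)
  have mon: "column_monomial a" "column_monomial ?b"
    using a column_monomial_fun_mat by metis+
  show ?thesis
    by (rule that[OF inv]) (use fmat mon comp in \<open>auto intro: column_monomial_transpose_left_inverse\<close>)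
qed

lemma subcategory_pure:
  "symmetric_monoidal_subcategory FStoch {f. is_fmat f \<and> column_monomial f}"
  unfolding symmetric_monoidal_subcategory_def FStoch_sel
proof (intro conjI ballI)
  fix a :: "'a fmat"
  assume a: "a \<in> structure_arrows FStoch"
  obtain b where b: "inverse_arrows FStoch a b" "column_monomial a" "column_monomial b"
    using structure_arrows_monomial[OF a] .
  then have "is_fmat a" "is_fmat b" by (auto simp: inverse_arrows_def in_hom_FStoch)
  with b show "a \<in> {f. is_fmat f \<and> column_monomial f}"
    "\<exists>b\<in>{f. is_fmat f \<and> column_monomial f}. inverse_arrows FStoch a b" by auto
qed (auto simp: is_fmat_intros column_monomial_fun_mat column_monomial_comp column_monomial_kronecker)

lemma subcategory_copure:
  "symmetric_monoidal_subcategory FStoch {f. is_fmat f \<and> column_monomial (transpose_fmat f)}"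
  unfolding symmetric_monoidal_subcategory_def FStoch_sel
proof (intro conjI ballI)
  fix a :: "'a fmat"
  assume a: "a \<in> structure_arrows FStoch"
  obtain b where b: "inverse_arrows FStoch a b"
    "column_monomial (transpose_fmat a)" "column_monomial (transpose_fmat b)"
    using structure_arrows_monomial[OF a] .
  then have "is_fmat a" "is_fmat b" by (auto simp: inverse_arrows_def in_hom_FStoch)
  with b show "a \<in> {f. is_fmat f \<and> column_monomial (transpose_fmat f)}"
    "\<exists>b\<in>{f. is_fmat f \<and> column_monomial (transpose_fmat f)}. inverse_arrows FStoch a b" by auto
qed (auto simp: is_fmat_intros column_monomial_fun_mat column_monomial_comp
    column_monomial_kronecker transpose_comp transpose_kronecker)

theorem lemma10:
  shows "(symmetric_monoidal_subcategory FStoch (pure_morphisms :: 'a fmat set) \<and>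
          pure_morphisms =
            {f :: 'a fmat. f \<in> Arr FStoch \<and> (\<forall>x\<in>src f. \<exists>\<^sub>\<le>\<^sub>1 y. y \<in> tgt f \<and> entry f y x \<noteq> 0)}) \<and>
         (symmetric_monoidal_subcategory FStoch (copure_morphisms :: 'a fmat set) \<and>
          copure_morphisms =
            {f :: 'a fmat. f \<in> Arr FStoch \<and> (\<forall>y\<in>tgt f. \<exists>\<^sub>\<le>\<^sub>1 x. x \<in> src f \<and> entry f y x \<noteq> 0)})"
proof -
  have copure: "copure_morphisms = {f :: 'a fmat. is_fmat f \<and> column_monomial (transpose_fmat f)}"
    by (auto simp: copure_iff_transpose_pure pure_morphisms_eq)
  \<comment> \<open>Transposition exchanges \<open>src\<close> and \<open>tgt\<close>, so unfolding
    \<open>column_monomial\<close> at the transpose yields the condition on rows.\<close>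
  show ?thesis
    using subcategory_pure subcategory_copure
    unfolding copure pure_morphisms_eq by (simp add: column_monomial_def)
qed

end
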